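(* Let $S=\langle n_0,\ldots,n_p\rangle$ be a numerical semigroup on a compound sequence (NSCS), with associated integers $a_1,\ldots,a_p,b_1,\ldots,b_p$. Then the catenary degree of $S$ is $c(S)=\max\{b_1,b_2,\ldots,b_p\}$.
   Context: Let $\mathbb{N}$ be the positive integers and $\mathbb{N}_0$ the nonnegative integers. A compound sequence is a sequence $\{n_0,\ldots,n_p\}$ with $n_i=b_1b_2\cdots b_i\,a_{i+1}a_{i+2}\cdots a_p$ for $i\in[0,p]$, where $p,a_1,\ldots,a_p,b_1,\ldots,b_p\in\mathbb{N}$ satisfy $2\le a_i<b_i$ for all $i\in[1,p]$ and $\gcd(a_i,b_j)=1$ for all $i,j\in[1,p]$ with $i\ge j$. An NSCS is a numerical semigroup $S=\langle n_0,\ldots,n_p\rangle$ whose minimal generators form a compound sequence. The factorization homomorphism is $\phi:\mathbb{N}_0^{p+1}\to S$, $\phi(x_0,\ldots,x_p)=x_0n_0+\cdots+x_pn_p$; the elements of $\phi^{-1}(n)$ are the factorizations of $n$. For $x\in\mathbb{N}_0^{p+1}$, $|x|=x_0+\cdots+x_p$. For $x,y\in\mathbb{N}_0^{p+1}$, $\gcd(x,y)=(\min\{x_0,y_0\},\ldots,\min\{x_p,y_p\})$ and $d(x,y)=\max\{|x-\gcd(x,y)|,|y-\gcd(x,y)|\}$. For $x,y\in\phi^{-1}(n)$, an $N$-chain from $x$ to $y$ is a sequence $x^0,x^1,\ldots,x^k\in\phi^{-1}(n)$ with $x^0=x$, $x^k=y$ and $d(x^i,x^{i+1})\le N$ for all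 $i\in[0,k-1]$. The catenary degree $c(n)$ of $n\in S$ is the minimal $N\in\mathbb{N}_0$ such that for any $x,y\in\phi^{-1}(n)$ there is an $N$-chain from $x$ to $y$, and $c(S)=\sup\{c(n):n\in S\}$. *)

theory Defs
  imports Complex_Main "HOL-Library.Extended_Nat"
begin

definition additive_submonoid :: "nat set \<Rightarrow> bool" where
  "additive_submonoid T \<longleftrightarrow> 0 \<in> T \<and> (\<forall>x\<in>T. \<forall>y\<in>T. x + y \<in> T)"

definition generated :: "nat set \<Rightarrow> nat set" where
  "generated A = additive_submonoid hull A"

definition numerical_semigroup :: "nat set \<Rightarrow> bool" where
  "numerical_semigroup S \<longleftrightarrow> additive_submonoid S \<and> finite (- S)"

definition minimal_generators :: "nat set \<Rightarrow> nat set \<Rightarrow> bool" where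
  "minimal_generators A S \<longleftrightarrow> generated A = S \<and> (\<forall>B. B \<subset> A \<longrightarrow> generated B \<noteq> S)"

text \<open>Sequences indexed by \<open>[1,p]\<close> or \<open>[0,p]\<close> are functions on \<^typ>\<open>nat\<close>
  of which only the values on that range matter.\<close>

definition compound_params :: "nat \<Rightarrow> (nat \<Rightarrow> nat) \<Rightarrow> (nat \<Rightarrow> nat) \<Rightarrow> bool" where
  "compound_params p a b \<longleftrightarrow>
     1 \<le> p \<and>
     (\<forall>i\<in>{1..p}. 2 \<le> a i \<and> a i < b i) \<and>
     (\<forall>i\<in>{1..p}. \<forall>j\<in>{1..p}. j \<le> i \<longrightarrow> gcd (a i) (b j) = 1)"

definition compound_seq :: "nat \<Rightarrow> (nat \<Rightarrow> nat) \<Rightarrow> (nat \<Rightarrow> nat) \<Rightarrow> nat \<Rightarrow> nat" where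
  "compound_seq p a b i = (\<Prod>j = 1..i. b j) * (\<Prod>j = i + 1..p. a j)"

definition NSCS :: "nat set \<Rightarrow> nat \<Rightarrow> (nat \<Rightarrow> nat) \<Rightarrow> (nat \<Rightarrow> nat) \<Rightarrow> bool" where
  "NSCS S p a b \<longleftrightarrow>
     numerical_semigroup S \<and>
     compound_params p a b \<and>
     minimal_generators (compound_seq p a b ` {0..p}) S"

text \<open>Vectors in \<open>\<nat>\<^sub>0\<^bsup>p+1\<^esup>\<close> are functions vanishing outside \<open>[0,p]\<close>.\<close>

definition vectors :: "nat \<Rightarrow> (nat \<Rightarrow> nat) set" where
  "vectors p = {x. \<forall>i>p. x i = 0}"

definition factorization_hom :: "nat \<Rightarrow> (nat \<Rightarrow> nat) \<Rightarrow> (nat \<Rightarrow> nat) \<Rightarrow> nat" where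
  "factorization_hom p n x = (\<Sum>i = 0..p. x i * n i)"

definition factorizations :: "nat \<Rightarrow> (nat \<Rightarrow> nat) \<Rightarrow> nat \<Rightarrow> (nat \<Rightarrow> nat) set" where
  "factorizations p n m = {x \<in> vectors p. factorization_hom p n x = m}"

definition vec_size :: "nat \<Rightarrow> (nat \<Rightarrow> nat) \<Rightarrow> nat" where
  "vec_size p x = (\<Sum>i = 0..p. x i)"

definition vec_gcd :: "(nat \<Rightarrow> nat) \<Rightarrow> (nat \<Rightarrow> nat) \<Rightarrow> nat \<Rightarrow> nat" where
  "vec_gcd x y = (\<lambda>i. min (x i) (y i))"

text \<open>The subtractions below do not truncate, since \<^term>\<open>vec_gcd x y\<close> is
  componentwise at most \<open>x\<close> and \<open>y\<close>.\<close>

definition vec_dist :: "nat \<Rightarrow> (nat \<Rightarrow> nat) \<Rightarrow> (nat \<Rightarrow> nat) \<Rightarrow> nat" where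
  "vec_dist p x y =
     max (vec_size p (\<lambda>i. x i - vec_gcd x y i)) (vec_size p (\<lambda>i. y i - vec_gcd x y i))"

definition has_chain ::
  "nat \<Rightarrow> (nat \<Rightarrow> nat) \<Rightarrow> nat \<Rightarrow> nat \<Rightarrow> (nat \<Rightarrow> nat) \<Rightarrow> (nat \<Rightarrow> nat) \<Rightarrow> bool" where
  "has_chain p n m N x y \<longleftrightarrow>
     (\<exists>(k::nat) z. z 0 = x \<and> z k = y \<and>
        (\<forall>i\<le>k. z i \<in> factorizations p n m) \<and>
        (\<forall>i<k. vec_dist p (z i) (z (i + 1)) \<le> N))"

text \<open>For positive generators every element has finitely many factorizations, so a
  suitable \<open>N\<close> exists and \<^const>\<open>Least\<close> is a genuine minimum.\<close>

definition catenary_degree :: "nat \<Rightarrow> (nat \<Rightarrow> nat) \<Rightarrow> nat \<Rightarrow> nat" where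
  "catenary_degree p n m =
     (LEAST N. \<forall>x\<in>factorizations p n m. \<forall>y\<in>factorizations p n m. has_chain p n m N x y)"

text \<open>The supremum is taken in \<^typ>\<open>enat\<close>, where it exists without assuming
  boundedness.\<close>

definition semigroup_catenary_degree :: "nat \<Rightarrow> (nat \<Rightarrow> nat) \<Rightarrow> nat set \<Rightarrow> enat" where
  "semigroup_catenary_degree p n S = (SUP m\<in>S. enat (catenary_degree p n m))"

end

theory Submission
  imports Defs "HOL-Number_Theory.Cong" "HOL-Library.Function_Algebras"
begin

text \<open>
  Consecutive generators satisfy \<open>a\<^sub>i n\<^sub>i = b\<^sub>i n\<^bsub>i-1\<^esub>\<close>.  Trading \<open>b\<^sub>i\<close> copies of
  \<open>n\<^bsub>i-1\<^esub>\<close> for \<open>a\<^sub>i\<close> copies of \<open>n\<^sub>i\<close> is a step of distance at most \<open>b\<^sub>i\<close> that shortens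
  the factorization, so every factorization is joined by such steps to one with
  \<open>x\<^bsub>i-1\<^esub> < b\<^sub>i\<close> for all \<open>i\<close>.  Reducing modulo \<open>b\<^sub>1\<close>, then \<open>b\<^sub>1 b\<^sub>2\<close>, and so on shows that there
  is only one such factorization, whence \<open>c(S) \<le> max b\<^sub>i\<close>.

  Conversely let \<open>m = b\<^sub>i n\<^bsub>i-1\<^esub> = A B\<close> with \<open>A = a\<^sub>i \<cdots> a\<^sub>p\<close> and \<open>B = b\<^sub>1 \<cdots> b\<^sub>i\<close> coprime.
  In a factorization of \<open>m\<close>, the part contributed by the generators below index \<open>i\<close> is divisible
  by \<open>A\<close> and the rest by \<open>B\<close>; as the two parts add up to \<open>A B\<close>, one of them vanishes.  Both
  kinds of factorization occur, they have disjoint supports, and those using only indices below \<open>i\<close>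
  have length at least \<open>b\<^sub>i\<close>, so every chain between the two kinds has a step of distance at least
  \<open>b\<^sub>i\<close>.
\<close>

section \<open>The factorization homomorphism\<close>

definition unit_vec :: "nat \<Rightarrow> nat \<Rightarrow> nat \<Rightarrow> nat" where
  "unit_vec j c = (\<lambda>_. 0)(j := c)"

lemma diff_unit_vec_add_unit_vec:
  assumes "c \<le> x j"
  shows "x - unit_vec j c + unit_vec j c = x"
  using assms by (auto simp: unit_vec_def)

lemma factorization_hom_add:
  "factorization_hom p n (x + y) = factorization_hom p n x + factorization_hom p n y"
  by (simp add: factorization_hom_def distrib_right sum.distrib)

lemma factorization_hom_unit_vec:
  assumes "j \<le> p"
  shows "factorization_hom p n (unit_vec j c) = c * n j"
proof -
  have "factorization_hom p n (unit_vec j c) = (\<Sum>i = 0..p. if i = j then c * n i else 0)"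
    unfolding factorization_hom_def unit_vec_def by (rule sum.cong) auto
  then show ?thesis
    using assms by simp
qed

lemma vec_size_eq_factorization_hom: "vec_size p x = factorization_hom p (\<lambda>_. 1) x"
  by (simp add: vec_size_def factorization_hom_def)

lemma vec_size_add: "vec_size p (x + y) = vec_size p x + vec_size p y"
  by (simp add: vec_size_eq_factorization_hom factorization_hom_add)

lemma vec_size_unit_vec: "j \<le> p \<Longrightarrow> vec_size p (unit_vec j c) = c"
  by (simp add: vec_size_eq_factorization_hom factorization_hom_unit_vec)

lemma vec_size_le_factorization_hom:
  assumes "\<And>i. i \<le> p \<Longrightarrow> 0 < n i"
  shows "vec_size p x \<le> factorization_hom p n x"
  unfolding vec_size_def factorization_hom_def using assms
  by (intro sum_mono) (simp add: Suc_le_eq)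

lemma factorization_hom_le_vec_size_mult:
  assumes "\<And>i. i \<le> p \<Longrightarrow> x i \<noteq> 0 \<Longrightarrow> n i \<le> g"
  shows "factorization_hom p n x \<le> vec_size p x * g"
  unfolding vec_size_def factorization_hom_def sum_distrib_right
  using assms by (intro sum_mono) auto

lemma unit_vec_mem_factorizations:
  assumes "j \<le> p"
  shows "unit_vec j c \<in> factorizations p n (c * n j)"
  using assms factorization_hom_unit_vec[OF assms]
  by (auto simp: factorizations_def vectors_def unit_vec_def)

lemma factorizations_exchange:
  assumes "u \<in> factorizations p n l" "v \<in> factorizations p n l"
    and "z + u \<in> factorizations p n m"
  shows "z + v \<in> factorizations p n m"
  using assms by (simp add: factorizations_def vectors_def factorization_hom_add)

lemma factorization_hom_cong_first_difference:
  assumes "factorization_hom p n x = factorization_hom p n y" "k \<le> p"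
    and "\<And>j. j < k \<Longrightarrow> x j = y j" "\<And>j. k < j \<Longrightarrow> j \<le> p \<Longrightarrow> d dvd n j"
  shows "[x k * n k = y k * n k] (mod d)"
proof -
  define rest where "rest z = (\<Sum>j\<in>{0..p} - {k}. z j * n j)" for z
  have "[x j * n j = y j * n j] (mod d)" if "j \<in> {0..p} - {k}" for j
  proof (cases "j < k")
    case True
    then show ?thesis
      using assms(3) by simp
  next
    case False
    then have "d dvd n j"
      using that assms(4) by simp
    then show ?thesis
      by (meson cong_0_iff cong_sym cong_trans dvd_mult)
  qed
  then have rest_cong: "[rest x = rest y] (mod d)"
    unfolding rest_def by (rule cong_sum)
  have "factorization_hom p n z = z k * n k + rest z" for z
    unfolding factorization_hom_def rest_def using assms(2) by (intro sum.remove) auto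
  then have "[x k * n k + rest x = y k * n k + rest y] (mod d)"
    using assms(1) by simp
  also have "[y k * n k + rest y = y k * n k + rest x] (mod d)"
    using rest_cong by (intro cong_add cong_refl) (rule cong_sym)
  finally show ?thesis
    by (simp only: cong_add_rcancel_nat)
qed

lemma coprime_dvd_add_eq_mult_imp_zero:
  fixes A B L U :: nat
  assumes "coprime A B" "A dvd L" "B dvd U" "L + U = A * B"
  shows "L = 0 \<or> U = 0"
proof -
  have "A dvd U"
    using assms(2,4) by (metis dvd_add_right_iff dvd_triv_left)
  then have "A * B dvd U"
    using assms(1,3) by (simp add: divides_mult)
  then have "U = 0 \<or> A * B \<le> U"
    using dvd_imp_le by auto
  then show ?thesis
    using assms(4) by auto
qed

lemma coprime_factorization_dichotomy:
  assumes pos: "\<And>i. i \<le> p \<Longrightarrow> 0 < n i"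
    and "coprime A B"
    and A: "\<And>i. i \<le> p \<Longrightarrow> i \<in> J \<Longrightarrow> A dvd n i"
    and B: "\<And>i. i \<le> p \<Longrightarrow> i \<notin> J \<Longrightarrow> B dvd n i"
    and x: "x \<in> factorizations p n (A * B)"
  shows "(\<forall>i\<in>J. x i = 0) \<or> (\<forall>i\<in>-J. x i = 0)"
proof -
  define L where "L = (\<Sum>i\<in>{0..p} \<inter> J. x i * n i)"
  define U where "U = (\<Sum>i\<in>{0..p} - J. x i * n i)"
  have "L + U = A * B"
    using x sum.Int_Diff[of "{0..p}" "\<lambda>i. x i * n i" J]
    by (simp add: factorizations_def factorization_hom_def L_def U_def)
  moreover have "A dvd L"
    unfolding L_def using A by (intro dvd_sum dvd_mult) auto
  moreover have "B dvd U"
    unfolding U_def using B by (intro dvd_sum dvd_mult) auto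
  ultimately have "L = 0 \<or> U = 0"
    using coprime_dvd_add_eq_mult_imp_zero \<open>coprime A B\<close> by blast
  moreover have "x i * n i = 0 \<longleftrightarrow> x i = 0" if "i \<le> p" for i
    using pos[OF that] by simp
  ultimately have "(\<forall>i\<le>p. i \<in> J \<longrightarrow> x i = 0) \<or> (\<forall>i\<le>p. i \<notin> J \<longrightarrow> x i = 0)"
    by (auto simp: L_def U_def simp del: mult_eq_0_iff)
  moreover have "x i = 0" if "p < i" for i
    using x that by (simp add: factorizations_def vectors_def)
  ultimately show ?thesis
    by (metis ComplD not_le)
qed

section \<open>The distance between vectors\<close>

lemma vec_dist_commute: "vec_dist p x y = vec_dist p y x"
  by (simp add: vec_dist_def vec_gcd_def max.commute min.commute)

lemma vec_dist_add_left: "vec_dist p (z + u) (z + v) = vec_dist p u v"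
  by (simp add: vec_dist_def vec_gcd_def flip: min_add_distrib_right)

lemma vec_dist_le_max_vec_size: "vec_dist p u v \<le> max (vec_size p u) (vec_size p v)"
  unfolding vec_dist_def vec_size_def by (intro max.mono sum_mono) auto

lemma vec_size_le_vec_dist:
  assumes "\<And>i. u i = 0 \<or> v i = 0"
  shows "vec_size p u \<le> vec_dist p u v"
proof -
  have "vec_gcd u v i = 0" for i
    using assms[of i] by (auto simp: vec_gcd_def)
  then show ?thesis
    by (simp add: vec_dist_def)
qed

section \<open>Chains and the catenary degree\<close>

definition chain_step :: "nat \<Rightarrow> (nat \<Rightarrow> nat) \<Rightarrow> nat \<Rightarrow> nat \<Rightarrow> (nat \<Rightarrow> nat) \<Rightarrow> (nat \<Rightarrow> nat) \<Rightarrow> bool" where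
  "chain_step p n m N x y \<longleftrightarrow>
     x \<in> factorizations p n m \<and> y \<in> factorizations p n m \<and> vec_dist p x y \<le> N"

lemma symp_chain_step: "symp (chain_step p n m N)"
  by (auto simp: symp_def chain_step_def vec_dist_commute)

lemma chain_step_exchange:
  assumes "u \<in> factorizations p n l" "v \<in> factorizations p n l"
    and "z + u \<in> factorizations p n m" "vec_size p u \<le> N" "vec_size p v \<le> N"
  shows "chain_step p n m N (z + u) (z + v)"
  using assms factorizations_exchange[OF assms(1-3)]
    order_trans[OF vec_dist_le_max_vec_size, of p u v N]
  by (simp add: chain_step_def vec_dist_add_left)

lemma has_chain_iff_rtranclp:
  "has_chain p n m N x y \<longleftrightarrow> x \<in> factorizations p n m \<and> (chain_step p n m N)\<^sup>*\<^sup>* x y"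
proof -
  let ?F = "factorizations p n m"
  have "(\<forall>i\<le>k. z i \<in> ?F) \<and> (\<forall>i<k. vec_dist p (z i) (z (i + 1)) \<le> N) \<longleftrightarrow>
      z 0 \<in> ?F \<and> (\<forall>i<k. chain_step p n m N (z i) (z (Suc i)))" for k z
  proof -
    have "(\<forall>i\<le>k. z i \<in> ?F) \<longleftrightarrow> z 0 \<in> ?F \<and> (\<forall>i<k. z (Suc i) \<in> ?F)"
      using All_less_Suc2[of k "\<lambda>i. z i \<in> ?F"] by (simp add: less_Suc_eq_le)
    then show ?thesis
      by (auto simp: chain_step_def)
  qed
  then show ?thesis
    unfolding has_chain_def rtranclp_power relpowp_fun_conv by auto
qed

lemma has_chain_mono:
  assumes "has_chain p n m M x y" "M \<le> N"
  shows "has_chain p n m N x y"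
  using assms mono_rtranclp[of "chain_step p n m M" "chain_step p n m N"]
  by (auto simp: has_chain_iff_rtranclp chain_step_def)

lemma has_chain_bounded_by_element:
  assumes "\<And>i. i \<le> p \<Longrightarrow> 0 < n i"
    and x: "x \<in> factorizations p n m" and y: "y \<in> factorizations p n m"
  shows "has_chain p n m m x y"
proof -
  have "vec_size p z \<le> m" if "z \<in> factorizations p n m" for z
    using vec_size_le_factorization_hom[of p n z] assms(1) that by (simp add: factorizations_def)
  then have "chain_step p n m m x y"
    using x y order_trans[OF vec_dist_le_max_vec_size, of p x y m] by (simp add: chain_step_def)
  then show ?thesis
    using x by (auto simp: has_chain_iff_rtranclp)
qed

lemma catenary_degree_le_iff:
  assumes "\<And>i. i \<le> p \<Longrightarrow> 0 < n i"
  shows "catenary_degree p n m \<le> N \<longleftrightarrow>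
    (\<forall>x\<in>factorizations p n m. \<forall>y\<in>factorizations p n m. has_chain p n m N x y)"
    (is "_ \<longleftrightarrow> ?connected N")
proof
  have "?connected m"
    using has_chain_bounded_by_element[of p n] assms by simp
  then have "?connected (catenary_degree p n m)"
    unfolding catenary_degree_def by (rule LeastI)
  then show "?connected N" if "catenary_degree p n m \<le> N"
    using that has_chain_mono by blast
  show "catenary_degree p n m \<le> N" if "?connected N"
    unfolding catenary_degree_def using that by (rule Least_le)
qed

lemma rtranclp_crossing:
  assumes "R\<^sup>*\<^sup>* x y" "x \<in> X" "y \<notin> X"
  obtains u v where "R u v" "u \<in> X" "v \<notin> X"
  using assms by (induction rule: rtranclp_induct) auto

lemma catenary_degree_ge_if_separated:
  assumes pos: "\<And>i. i \<le> p \<Longrightarrow> 0 < n i"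
    and x: "x \<in> factorizations p n m" "x \<in> X"
    and y: "y \<in> factorizations p n m" "y \<notin> X"
    and separated: "\<And>u v. u \<in> factorizations p n m \<Longrightarrow> u \<in> X \<Longrightarrow>
      v \<in> factorizations p n m \<Longrightarrow> v \<notin> X \<Longrightarrow> N \<le> vec_dist p u v"
  shows "N \<le> catenary_degree p n m"
proof -
  have "has_chain p n m (catenary_degree p n m) x y"
    using catenary_degree_le_iff[of p n m] pos x(1) y(1) by blast
  then have "(chain_step p n m (catenary_degree p n m))\<^sup>*\<^sup>* x y"
    by (simp add: has_chain_iff_rtranclp)
  then obtain u v where "chain_step p n m (catenary_degree p n m) u v" "u \<in> X" "v \<notin> X"
    using x(2) y(2) by (rule rtranclp_crossing)
  then show ?thesis
    using separated by (auto simp: chain_step_def intro: order_trans)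
qed

section \<open>Compound sequences\<close>

context
  fixes p :: nat and a b :: "nat \<Rightarrow> nat"
  assumes params: "compound_params p a b"
begin

private abbreviation (input) n :: "nat \<Rightarrow> nat" where
  "n \<equiv> compound_seq p a b"

lemma a_less_b: "1 \<le> i \<Longrightarrow> i \<le> p \<Longrightarrow> a i < b i"
  using params by (simp add: compound_params_def)

lemma a_pos:
  assumes "1 \<le> i" "i \<le> p"
  shows "0 < a i"
proof -
  have "2 \<le> a i"
    using params assms by (simp add: compound_params_def)
  then show ?thesis
    by simp
qed

lemma coprime_a_b: "1 \<le> j \<Longrightarrow> j \<le> i \<Longrightarrow> i \<le> p \<Longrightarrow> coprime (a i) (b j)"
  using params by (simp add: compound_params_def coprime_iff_gcd_eq_1)

lemma compound_seq_pos: "i \<le> p \<Longrightarrow> 0 < n i"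
  unfolding compound_seq_def
  by (intro mult_pos_pos prod_pos) (auto intro: a_pos order.strict_trans[OF a_pos a_less_b])

lemma b_mult_compound_seq: "b (Suc k) * n k = prod a {Suc k..p} * prod b {1..Suc k}"
  by (simp add: compound_seq_def)

lemma a_mult_compound_seq_Suc:
  assumes "k < p"
  shows "a (Suc k) * n (Suc k) = b (Suc k) * n k"
  using assms unfolding b_mult_compound_seq
  by (simp add: compound_seq_def prod.atLeast_Suc_atMost[of "Suc k" p a])

lemma unit_vec_Suc_mem_factorizations:
  assumes "k < p"
  shows "unit_vec (Suc k) (a (Suc k)) \<in> factorizations p n (b (Suc k) * n k)"
  using assms unit_vec_mem_factorizations[of "Suc k" p "a (Suc k)" n]
  by (simp add: a_mult_compound_seq_Suc)

lemma compound_seq_mono: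
  assumes "j \<le> k" "k \<le> p"
  shows "n j \<le> n k"
  using assms
proof (induction k rule: dec_induct)
  case (step k)
  have "a (Suc k) * n k \<le> b (Suc k) * n k"
    using a_less_b[of "Suc k"] step.prems by (intro mult_right_mono) auto
  also have "\<dots> = a (Suc k) * n (Suc k)"
    using a_mult_compound_seq_Suc[of k] step.prems by simp
  finally have "n k \<le> n (Suc k)"
    using a_pos[of "Suc k"] step.prems by simp
  then show ?case
    using step by simp
qed simp

lemma prod_b_dvd_compound_seq: "i \<le> j \<Longrightarrow> prod b {1..i} dvd n j"
  unfolding compound_seq_def by (intro dvd_mult2 prod_dvd_prod_subset) auto

lemma prod_a_dvd_compound_seq: "j < i \<Longrightarrow> prod a {i..p} dvd n j"
  unfolding compound_seq_def by (intro dvd_mult prod_dvd_prod_subset) auto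

lemma coprime_prod_a_prod_b: "coprime (prod a {k..p}) (prod b {1..k})"
  by (intro prod_coprime_left prod_coprime_right coprime_a_b) auto

lemma cong_mult_compound_seq_imp_cong:
  assumes "k < p" "[s * n k = t * n k] (mod prod b {1..Suc k})"
  shows "[s = t] (mod b (Suc k))"
proof -
  define A where "A = prod a {Suc k..p}"
  define B where "B = prod b {1..k}"
  have n_k: "n k = B * A"
    by (simp add: compound_seq_def A_def B_def)
  then have "B \<noteq> 0"
    using compound_seq_pos[of k] assms(1) by auto
  have "[B * (s * A) = B * (t * A)] (mod B * b (Suc k))"
    using assms(2) by (simp add: n_k B_def mult.left_commute)
  then have "[s * A = t * A] (mod b (Suc k))"
    using \<open>B \<noteq> 0\<close> by (simp add: cong_def)
  moreover have "coprime A (b (Suc k))"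
    unfolding A_def by (intro prod_coprime_left coprime_a_b) auto
  ultimately show ?thesis
    by (simp add: cong_mult_rcancel_nat)
qed

subsection \<open>The upper bound\<close>

definition reduced :: "(nat \<Rightarrow> nat) \<Rightarrow> bool" where
  "reduced x \<longleftrightarrow> (\<forall>k<p. x k < b (Suc k))"

lemma reduced_factorization_unique:
  assumes x: "x \<in> factorizations p n m" "reduced x"
    and y: "y \<in> factorizations p n m" "reduced y"
  shows "x = y"
proof
  fix k
  have hom_eq: "factorization_hom p n x = factorization_hom p n y"
    using x(1) y(1) by (simp add: factorizations_def)
  show "x k = y k"
  proof (induction k rule: less_induct)
    case (less k)
    consider (inner) "k < p" | (top) "k = p" | (outside) "p < k"
      by linarith
    then show ?case
    proof cases
      case inner
      have "[x k * n k = y k * n k] (mod prod b {1..Suc k})"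
        using inner less.IH
        by (intro factorization_hom_cong_first_difference[OF hom_eq] prod_b_dvd_compound_seq) auto
      then have "[x k = y k] (mod b (Suc k))"
        by (rule cong_mult_compound_seq_imp_cong[OF inner])
      then show ?thesis
        using inner x(2) y(2) by (simp add: reduced_def cong_less_modulus_unique_nat)
    next
      case top
      \<comment> \<open>No generator lies above index \<open>p\<close>, so the modulus may even be \<open>0\<close>.\<close>
      have "[x k * n k = y k * n k] (mod 0)"
        using top less.IH by (intro factorization_hom_cong_first_difference[OF hom_eq]) auto
      then show ?thesis
        using top compound_seq_pos[of p] by simp
    next
      case outside
      then show ?thesis
        using x(1) y(1) by (simp add: factorizations_def vectors_def)
    qed
  qed
qed

lemma ex_shortening_chain_step:
  assumes bound: "\<And>k. k < p \<Longrightarrow> b (Suc k) \<le> N"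
    and x: "x \<in> factorizations p n m" "\<not> reduced x"
  obtains y where "chain_step p n m N x y" "vec_size p y < vec_size p x"
proof -
  obtain k where k: "k < p" "b (Suc k) \<le> x k"
    using x(2) by (auto simp: reduced_def not_less)
  define u where "u = unit_vec k (b (Suc k))"
  define v where "v = unit_vec (Suc k) (a (Suc k))"
  define z where "z = x - u"
  have x_eq: "x = z + u"
    using diff_unit_vec_add_unit_vec[of "b (Suc k)" x k] k(2) by (simp add: z_def u_def)
  have size_less: "vec_size p v < vec_size p u"
    using k(1) a_less_b[of "Suc k"] by (simp add: u_def v_def vec_size_unit_vec)
  have size_le: "vec_size p u \<le> N"
    using k(1) bound by (simp add: u_def vec_size_unit_vec)
  have "u \<in> factorizations p n (b (Suc k) * n k)"
    using k(1) by (simp add: u_def unit_vec_mem_factorizations)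
  moreover have "v \<in> factorizations p n (b (Suc k) * n k)"
    unfolding v_def using k(1) by (rule unit_vec_Suc_mem_factorizations)
  ultimately have "chain_step p n m N x (z + v)"
    using x(1) size_less size_le unfolding x_eq by (intro chain_step_exchange) auto
  moreover have "vec_size p (z + v) < vec_size p x"
    using size_less by (simp add: x_eq vec_size_add)
  ultimately show thesis
    by (rule that)
qed

lemma ex_chain_to_reduced:
  assumes bound: "\<And>k. k < p \<Longrightarrow> b (Suc k) \<le> N" and "x \<in> factorizations p n m"
  shows "\<exists>y. y \<in> factorizations p n m \<and> reduced y \<and> (chain_step p n m N)\<^sup>*\<^sup>* x y"
  using assms(2)
proof (induction "vec_size p x" arbitrary: x rule: less_induct)
  case less
  show ?case
  proof (cases "reduced x")
    case True
    then show ?thesis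
      using less.prems by blast
  next
    case False
    then obtain y where "chain_step p n m N x y" "vec_size p y < vec_size p x"
      using ex_shortening_chain_step[OF bound less.prems] by blast
    then show ?thesis
      using less.hyps by (meson chain_step_def converse_rtranclp_into_rtranclp)
  qed
qed

lemma catenary_degree_compound_seq_le:
  assumes bound: "\<And>k. k < p \<Longrightarrow> b (Suc k) \<le> N"
  shows "catenary_degree p n m \<le> N"
proof -
  have "has_chain p n m N x y"
    if x: "x \<in> factorizations p n m" and y: "y \<in> factorizations p n m" for x y
  proof -
    obtain u where u: "u \<in> factorizations p n m" "reduced u" "(chain_step p n m N)\<^sup>*\<^sup>* x u"
      using ex_chain_to_reduced[OF bound x] by blast
    obtain v where v: "v \<in> factorizations p n m" "reduced v" "(chain_step p n m N)\<^sup>*\<^sup>* y v"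
      using ex_chain_to_reduced[OF bound y] by blast
    have "u = v"
      using u(1,2) v(1,2) by (rule reduced_factorization_unique)
    moreover have "(chain_step p n m N)\<^sup>*\<^sup>* v y"
      using v(3) by (rule sympD[OF symp_rtranclp[OF symp_chain_step]])
    ultimately show ?thesis
      using x u(3) by (simp add: has_chain_iff_rtranclp)
  qed
  then show ?thesis
    by (simp add: catenary_degree_le_iff compound_seq_pos)
qed

subsection \<open>The lower bound\<close>

lemma compound_seq_factorization_dichotomy:
  assumes "x \<in> factorizations p n (b (Suc k) * n k)"
  shows "(\<forall>i\<le>k. x i = 0) \<or> (\<forall>i>k. x i = 0)"
proof -
  have "(\<forall>i\<in>{..k}. x i = 0) \<or> (\<forall>i\<in>-{..k}. x i = 0)"
  proof (rule coprime_factorization_dichotomy)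
    show "coprime (prod a {Suc k..p}) (prod b {1..Suc k})"
      by (rule coprime_prod_a_prod_b)
    show "x \<in> factorizations p n (prod a {Suc k..p} * prod b {1..Suc k})"
      using assms by (simp only: b_mult_compound_seq)
    show "prod a {Suc k..p} dvd n i" if "i \<in> {..k}" for i
      using that by (intro prod_a_dvd_compound_seq) simp
    show "prod b {1..Suc k} dvd n i" if "i \<notin> {..k}" for i
      using that by (intro prod_b_dvd_compound_seq) simp
  qed (rule compound_seq_pos)
  then show ?thesis
    by auto
qed

lemma vec_size_ge_if_supported_below:
  assumes k: "k \<le> p" and x: "x \<in> factorizations p n (c * n k)" "\<forall>i>k. x i = 0"
  shows "c \<le> vec_size p x"
proof -
  have "c * n k = factorization_hom p n x"
    using x(1) by (simp add: factorizations_def)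
  also have "\<dots> \<le> vec_size p x * n k"
    using x(2) k by (intro factorization_hom_le_vec_size_mult compound_seq_mono) (auto intro: leI)
  finally show ?thesis
    using compound_seq_pos[OF k] by simp
qed

lemma catenary_degree_compound_seq_ge:
  assumes k: "k < p"
  shows "b (Suc k) \<le> catenary_degree p n (b (Suc k) * n k)"
proof (rule catenary_degree_ge_if_separated)
  let ?m = "b (Suc k) * n k"
  let ?lower = "{x. \<forall>i>k. x i = 0}"
  show "unit_vec k (b (Suc k)) \<in> factorizations p n ?m"
    using k by (simp add: unit_vec_mem_factorizations)
  show "unit_vec (Suc k) (a (Suc k)) \<in> factorizations p n ?m"
    using k by (rule unit_vec_Suc_mem_factorizations)
  show "unit_vec k (b (Suc k)) \<in> ?lower"
    by (simp add: unit_vec_def)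
  show "unit_vec (Suc k) (a (Suc k)) \<notin> ?lower"
    using k a_pos[of "Suc k"] by (auto simp: unit_vec_def)
  show "b (Suc k) \<le> vec_dist p u v"
    if u: "u \<in> factorizations p n ?m" "u \<in> ?lower"
      and v: "v \<in> factorizations p n ?m" "v \<notin> ?lower" for u v
  proof -
    have "\<forall>i\<le>k. v i = 0"
      using compound_seq_factorization_dichotomy[OF v(1)] v(2) by blast
    then have disjoint: "u i = 0 \<or> v i = 0" for i
      using u(2) by (cases "i \<le> k") auto
    have "b (Suc k) \<le> vec_size p u"
      using k u by (intro vec_size_ge_if_supported_below) auto
    also have "\<dots> \<le> vec_dist p u v"
      by (intro vec_size_le_vec_dist disjoint)
    finally show ?thesis .
  qed
qed (rule compound_seq_pos)

end

lemma additive_submonoid_mult: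
  assumes "additive_submonoid T" "g \<in> T"
  shows "c * g \<in> T"
  using assms by (induction c) (simp_all add: additive_submonoid_def)

lemma compound_seq_mem_NSCS:
  assumes "NSCS S p a b" "i \<le> p"
  shows "compound_seq p a b i \<in> S"
proof -
  have "compound_seq p a b i \<in> generated (compound_seq p a b ` {0..p})"
    unfolding generated_def using assms(2) by (intro hull_inc) simp
  then show ?thesis
    using assms(1) by (simp add: NSCS_def minimal_generators_def)
qed

theorem theorem18:
  fixes S :: "nat set" and p :: nat and a b :: "nat \<Rightarrow> nat"
  assumes "NSCS S p a b"
  shows "semigroup_catenary_degree p (compound_seq p a b) S = enat (Max (b ` {1..p}))"
proof -
  let ?n = "compound_seq p a b" and ?M = "Max (b ` {1..p})"
  have params: "compound_params p a b" and submonoid: "additive_submonoid S"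
    using assms by (simp_all add: NSCS_def numerical_semigroup_def)
  have "?M \<in> b ` {1..p}"
    using params by (intro Max_in) (auto simp: compound_params_def)
  then obtain k where k: "k < p" "?M = b (Suc k)"
    unfolding image_Suc_lessThan[symmetric] by blast
  have "b (Suc k) * ?n k \<in> S"
    using k(1) by (intro additive_submonoid_mult[OF submonoid] compound_seq_mem_NSCS[OF assms]) simp
  then have "enat ?M \<le> semigroup_catenary_degree p ?n S"
    unfolding semigroup_catenary_degree_def k(2)
    using catenary_degree_compound_seq_ge[OF params k(1)] by (intro SUP_upper2) auto
  moreover have "semigroup_catenary_degree p ?n S \<le> enat ?M"
    unfolding semigroup_catenary_degree_def
    using catenary_degree_compound_seq_le[OF params, of ?M] by (intro SUP_least) simp
  ultimately show ?thesis
    by (intro antisym)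
qed

end
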